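(* For every $a=a_0+a_1\mathbf{e}_1+a_2\mathbf{e}_2+a_3\mathbf{e}_3\in C\ell_2$ with $a_i\in\mathbb{R}$, $$e^a=\begin{cases} e^{a_0}\Big(\cosh\sqrt{V_a}+\dfrac{\Im(a)}{\sqrt{V_a}}\sinh\sqrt{V_a}\Big), & V_a>0;\\[2mm] e^{a_0}\Big(\cos\sqrt{-V_a}+\dfrac{\Im(a)}{\sqrt{-V_a}}\sin\sqrt{-V_a}\Big), & V_a<0;\\[2mm] e^{a_0}(1+\Im(a)), & V_a=0.\end{cases}$$
   Context: $C\ell_2=C\ell_{2,0}$ is the associative unital real algebra with $\mathbb{R}$-basis $\mathbf{e}_0=1,\mathbf{e}_1,\mathbf{e}_2,\mathbf{e}_3$ and multiplication rules $\mathbf{e}_1^2=\mathbf{e}_2^2=1$, $\mathbf{e}_3^2=-1$, $\mathbf{e}_1\mathbf{e}_2=\mathbf{e}_3=-\mathbf{e}_2\mathbf{e}_1$, $\mathbf{e}_2\mathbf{e}_3=-\mathbf{e}_1=-\mathbf{e}_3\mathbf{e}_2$, $\mathbf{e}_3\mathbf{e}_1=-\mathbf{e}_2=-\mathbf{e}_1\mathbf{e}_3$. For $a=a_0+a_1\mathbf{e}_1+a_2\mathbf{e}_2+a_3\mathbf{e}_3$ with $a_i\in\mathbb{R}$: $\Im(a)=a_1\mathbf{e}_1+a_2\mathbf{e}_2+a_3\mathbf{e}_3$ and $V_a=a_1^2+a_2^2-a_3^2$. The exponential function on $C\ell_2$ is defined by the power series $e^a=\sum_{k=0}^{\infty}\frac{a^k}{k!}$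 (convergence in the finite-dimensional real vector space $C\ell_2$). *)

theory Defs
  imports Complex_Main
begin

text \<open>
  The Clifford algebra of signature (2,0): the element with coordinates a0, a1, a2, a3 stands
  for \<open>a0 + a1 e1 + a2 e2 + a3 e3\<close>, where \<open>e3 = e1 e2\<close>.
\<close>

datatype cl2 = Cl2 (cf0: real) (cf1: real) (cf2: real) (cf3: real)

lemma cl2_eq_iff: "a = b \<longleftrightarrow> cf0 a = cf0 b \<and> cf1 a = cf1 b \<and> cf2 a = cf2 b \<and> cf3 a = cf3 b"
  by (cases a; cases b) simp

instantiation cl2 :: real_algebra_1
begin

definition zero_cl2 :: cl2 where "0 = Cl2 0 0 0 0"

definition one_cl2 :: cl2 where "1 = Cl2 1 0 0 0"

definition plus_cl2 :: "cl2 \<Rightarrow> cl2 \<Rightarrow> cl2" where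
  "a + b = Cl2 (cf0 a + cf0 b) (cf1 a + cf1 b) (cf2 a + cf2 b) (cf3 a + cf3 b)"

definition uminus_cl2 :: "cl2 \<Rightarrow> cl2" where
  "- a = Cl2 (- cf0 a) (- cf1 a) (- cf2 a) (- cf3 a)"

definition minus_cl2 :: "cl2 \<Rightarrow> cl2 \<Rightarrow> cl2" where
  "a - b = Cl2 (cf0 a - cf0 b) (cf1 a - cf1 b) (cf2 a - cf2 b) (cf3 a - cf3 b)"

definition scaleR_cl2 :: "real \<Rightarrow> cl2 \<Rightarrow> cl2" where
  "r *\<^sub>R a = Cl2 (r * cf0 a) (r * cf1 a) (r * cf2 a) (r * cf3 a)"

text \<open>The bilinear extension of the multiplication table of the basis (see \<open>cl2_mult_table\<close>).\<close>

definition times_cl2 :: "cl2 \<Rightarrow> cl2 \<Rightarrow> cl2" where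
  "a * b = Cl2
     (cf0 a * cf0 b + cf1 a * cf1 b + cf2 a * cf2 b - cf3 a * cf3 b)
     (cf0 a * cf1 b + cf1 a * cf0 b - cf2 a * cf3 b + cf3 a * cf2 b)
     (cf0 a * cf2 b + cf2 a * cf0 b - cf3 a * cf1 b + cf1 a * cf3 b)
     (cf0 a * cf3 b + cf3 a * cf0 b + cf1 a * cf2 b - cf2 a * cf1 b)"

instance
  by standard
    (auto simp: cl2_eq_iff zero_cl2_def one_cl2_def plus_cl2_def uminus_cl2_def minus_cl2_def
      scaleR_cl2_def times_cl2_def algebra_simps)

end

lemma cl2_coords [simp]:
  "cf0 0 = 0" "cf1 0 = 0" "cf2 0 = 0" "cf3 0 = 0"
  "cf0 1 = 1" "cf1 1 = 0" "cf2 1 = 0" "cf3 1 = 0"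
  "cf0 (a + b) = cf0 a + cf0 b" "cf1 (a + b) = cf1 a + cf1 b"
  "cf2 (a + b) = cf2 a + cf2 b" "cf3 (a + b) = cf3 a + cf3 b"
  "cf0 (- a) = - cf0 a" "cf1 (- a) = - cf1 a" "cf2 (- a) = - cf2 a" "cf3 (- a) = - cf3 a"
  "cf0 (a - b) = cf0 a - cf0 b" "cf1 (a - b) = cf1 a - cf1 b"
  "cf2 (a - b) = cf2 a - cf2 b" "cf3 (a - b) = cf3 a - cf3 b"
  "cf0 (r *\<^sub>R a) = r * cf0 a" "cf1 (r *\<^sub>R a) = r * cf1 a"
  "cf2 (r *\<^sub>R a) = r * cf2 a" "cf3 (r *\<^sub>R a) = r * cf3 a"
  "cf0 (a * b) = cf0 a * cf0 b + cf1 a * cf1 b + cf2 a * cf2 b - cf3 a * cf3 b"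
  "cf1 (a * b) = cf0 a * cf1 b + cf1 a * cf0 b - cf2 a * cf3 b + cf3 a * cf2 b"
  "cf2 (a * b) = cf0 a * cf2 b + cf2 a * cf0 b - cf3 a * cf1 b + cf1 a * cf3 b"
  "cf3 (a * b) = cf0 a * cf3 b + cf3 a * cf0 b + cf1 a * cf2 b - cf2 a * cf1 b"
  by (simp_all add: zero_cl2_def one_cl2_def plus_cl2_def uminus_cl2_def minus_cl2_def
      scaleR_cl2_def times_cl2_def)

definition e1 :: cl2 where "e1 = Cl2 0 1 0 0"
definition e2 :: cl2 where "e2 = Cl2 0 0 1 0"
definition e3 :: cl2 where "e3 = Cl2 0 0 0 1"

lemma cl2_mult_table:
  "e1 * e1 = 1" "e2 * e2 = 1" "e3 * e3 = - 1"
  "e1 * e2 = e3" "e2 * e1 = - e3"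
  "e2 * e3 = - e1" "e3 * e2 = e1"
  "e3 * e1 = - e2" "e1 * e3 = e2"
  by (simp_all add: cl2_eq_iff e1_def e2_def e3_def)

lemma cl2_basis:
  "a = a0 *\<^sub>R 1 + a1 *\<^sub>R e1 + a2 *\<^sub>R e2 + a3 *\<^sub>R e3 \<longleftrightarrow>
     cf0 a = a0 \<and> cf1 a = a1 \<and> cf2 a = a2 \<and> cf3 a = a3"
  by (auto simp add: cl2_eq_iff e1_def e2_def e3_def)

text \<open>
  The library function \<open>exp\<close> is the power series in a Banach algebra, so a submultiplicative
  norm is needed; the Euclidean norm of the coordinates is not submultiplicative. Writing
  \<open>a = z + w e1\<close> with \<open>z = a0 + a3 e3\<close> and \<open>w = a1 - a2 e3\<close>, where \<open>e3\<close> squares to \<open>-1\<close>, the norm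
  below is \<open>|z| + |w|\<close>; it is the operator norm of the isomorphic algebra of real 2 by 2 matrices.
  All norms on a finite-dimensional real vector space define the same convergence; that
  convergence here is coordinatewise is \<open>tendsto_cl2_iff\<close>.
\<close>

instantiation cl2 :: real_normed_algebra_1
begin

definition norm_cl2 :: "cl2 \<Rightarrow> real" where
  "norm a = sqrt ((cf0 a)\<^sup>2 + (cf3 a)\<^sup>2) + sqrt ((cf1 a)\<^sup>2 + (cf2 a)\<^sup>2)"

definition sgn_cl2 :: "cl2 \<Rightarrow> cl2" where
  "sgn (a :: cl2) = inverse (norm a) *\<^sub>R a"

definition dist_cl2 :: "cl2 \<Rightarrow> cl2 \<Rightarrow> real" where
  "dist (a :: cl2) b = norm (a - b)"

definition uniformity_cl2 :: "(cl2 \<times> cl2) filter" where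
  "uniformity = (INF e\<in>{0<..}. principal {(x :: cl2, y). dist x y < e})"

definition open_cl2 :: "cl2 set \<Rightarrow> bool" where
  "open (U :: cl2 set) \<longleftrightarrow> (\<forall>x\<in>U. eventually (\<lambda>(x', y). x' = x \<longrightarrow> y \<in> U) uniformity)"

instance
proof
  define z where "z = (\<lambda>a. Complex (cf0 a) (cf3 a))"
  define w where "w = (\<lambda>a. Complex (cf1 a) (- cf2 a))"
  have n: "norm a = cmod (z a) + cmod (w a)" for a :: cl2
    by (simp add: norm_cl2_def z_def w_def cmod_def)
  have add: "z (a + b) = z a + z b" "w (a + b) = w a + w b" for a b
    by (simp_all add: z_def w_def complex_eq_iff)
  have mult: "z (a * b) = z a * z b + w a * cnj (w b)" "w (a * b) = z a * w b + w a * cnj (z b)" for a b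
    by (simp_all add: z_def w_def complex_eq_iff algebra_simps)
  have scale: "z (r *\<^sub>R a) = r *\<^sub>R z a" "w (r *\<^sub>R a) = r *\<^sub>R w a" for r a
    by (simp_all add: z_def w_def complex_eq_iff)
  fix a b :: cl2 and r :: real and U :: "cl2 set"
  show "dist a b = norm (a - b)" by (rule dist_cl2_def)
  show "sgn a = inverse (norm a) *\<^sub>R a" by (rule sgn_cl2_def)
  show "uniformity = (INF e\<in>{0<..}. principal {(x :: cl2, y). dist x y < e})"
    by (rule uniformity_cl2_def)
  show "open U \<longleftrightarrow> (\<forall>x\<in>U. eventually (\<lambda>(x', y). x' = x \<longrightarrow> y \<in> U) uniformity)"
    by (rule open_cl2_def)
  show "norm a = 0 \<longleftrightarrow> a = 0"
    unfolding n by (auto simp add: add_nonneg_eq_0_iff z_def w_def complex_eq_iff cl2_eq_iff)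
  show "norm (a + b) \<le> norm a + norm b"
    unfolding n add using norm_triangle_ineq[of "z a" "z b"] norm_triangle_ineq[of "w a" "w b"]
    by linarith
  show "norm (r *\<^sub>R a) = \<bar>r\<bar> * norm a"
    unfolding n scale by (simp add: distrib_left)
  show "norm (a * b) \<le> norm a * norm b"
  proof -
    have "cmod (z a * z b + w a * cnj (w b)) \<le> cmod (z a) * cmod (z b) + cmod (w a) * cmod (w b)"
      by (rule order_trans[OF norm_triangle_ineq]) (simp add: norm_mult)
    moreover have "cmod (z a * w b + w a * cnj (z b)) \<le> cmod (z a) * cmod (w b) + cmod (w a) * cmod (z b)"
      by (rule order_trans[OF norm_triangle_ineq]) (simp add: norm_mult)
    ultimately show ?thesis
      unfolding n mult by (simp add: algebra_simps)
  qed
  show "norm (1 :: cl2) = 1"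
    by (simp add: norm_cl2_def)
qed

end

lemma abs_coords_le_norm_cl2:
  "\<bar>cf0 a\<bar> \<le> norm a" "\<bar>cf1 a\<bar> \<le> norm a" "\<bar>cf2 a\<bar> \<le> norm a" "\<bar>cf3 a\<bar> \<le> norm a"
proof -
  have *: "\<bar>x\<bar> \<le> sqrt (x\<^sup>2 + y\<^sup>2)" "\<bar>y\<bar> \<le> sqrt (x\<^sup>2 + y\<^sup>2)" "0 \<le> sqrt (x\<^sup>2 + y\<^sup>2)" for x y :: real
    by (simp_all add: real_le_rsqrt)
  note coord = *[where x = "cf0 a" and y = "cf3 a"] *[where x = "cf1 a" and y = "cf2 a"]
  show "\<bar>cf0 a\<bar> \<le> norm a" using coord unfolding norm_cl2_def by linarith
  show "\<bar>cf1 a\<bar> \<le> norm a" using coord unfolding norm_cl2_def by linarith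
  show "\<bar>cf2 a\<bar> \<le> norm a" using coord unfolding norm_cl2_def by linarith
  show "\<bar>cf3 a\<bar> \<le> norm a" using coord unfolding norm_cl2_def by linarith
qed

lemma bounded_linear_coords_cl2:
  "bounded_linear cf0" "bounded_linear cf1" "bounded_linear cf2" "bounded_linear cf3"
  by (rule bounded_linear_intro[where K = 1]; simp add: abs_coords_le_norm_cl2)+

lemma tendsto_Cl2:
  assumes "(f0 \<longlongrightarrow> l0) F" "(f1 \<longlongrightarrow> l1) F" "(f2 \<longlongrightarrow> l2) F" "(f3 \<longlongrightarrow> l3) F"
  shows "((\<lambda>x. Cl2 (f0 x) (f1 x) (f2 x) (f3 x)) \<longlongrightarrow> Cl2 l0 l1 l2 l3) F"
proof -
  have eq: "Cl2 x0 x1 x2 x3 = x0 *\<^sub>R 1 + x1 *\<^sub>R e1 + x2 *\<^sub>R e2 + x3 *\<^sub>R e3" for x0 x1 x2 x3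
    by (simp add: cl2_basis)
  show ?thesis
    unfolding eq by (intro tendsto_intros assms)
qed

lemma tendsto_cl2_iff:
  "(f \<longlongrightarrow> l) F \<longleftrightarrow>
     ((\<lambda>x. cf0 (f x)) \<longlongrightarrow> cf0 l) F \<and> ((\<lambda>x. cf1 (f x)) \<longlongrightarrow> cf1 l) F \<and>
     ((\<lambda>x. cf2 (f x)) \<longlongrightarrow> cf2 l) F \<and> ((\<lambda>x. cf3 (f x)) \<longlongrightarrow> cf3 l) F"
  using tendsto_Cl2[of "\<lambda>x. cf0 (f x)" "cf0 l" F "\<lambda>x. cf1 (f x)" "cf1 l"
      "\<lambda>x. cf2 (f x)" "cf2 l" "\<lambda>x. cf3 (f x)" "cf3 l"]
  by (auto intro: bounded_linear_coords_cl2[THEN bounded_linear.tendsto])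

instance cl2 :: banach
proof
  fix X :: "nat \<Rightarrow> cl2"
  assume "Cauchy X"
  then have "convergent (\<lambda>n. cf0 (X n))" "convergent (\<lambda>n. cf1 (X n))"
    "convergent (\<lambda>n. cf2 (X n))" "convergent (\<lambda>n. cf3 (X n))"
    by (auto intro!: Cauchy_convergent bounded_linear_coords_cl2[THEN bounded_linear.Cauchy])
  then obtain l0 l1 l2 l3 where "(\<lambda>n. cf0 (X n)) \<longlonglongrightarrow> l0" "(\<lambda>n. cf1 (X n)) \<longlonglongrightarrow> l1"
    "(\<lambda>n. cf2 (X n)) \<longlonglongrightarrow> l2" "(\<lambda>n. cf3 (X n)) \<longlonglongrightarrow> l3"
    unfolding convergent_def by blast
  then have "X \<longlonglongrightarrow> Cl2 l0 l1 l2 l3"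
    by (simp add: tendsto_cl2_iff)
  then show "convergent X"
    unfolding convergent_def by blast
qed

lemma exp_cl2_sums: "(\<lambda>k. a ^ k /\<^sub>R fact k) sums exp (a :: cl2)"
  by (rule exp_converges)

definition Im_cl2 :: "cl2 \<Rightarrow> cl2" where
  "Im_cl2 a = cf1 a *\<^sub>R e1 + cf2 a *\<^sub>R e2 + cf3 a *\<^sub>R e3"

definition V_cl2 :: "cl2 \<Rightarrow> real" where
  "V_cl2 a = (cf1 a)\<^sup>2 + (cf2 a)\<^sup>2 - (cf3 a)\<^sup>2"

end

theory Submission
  imports Defs
begin

text \<open>
  Since the scalar part is central, \<open>exp a = exp a\<^sub>0 * exp (\<Im> a)\<close>. The imaginary part squares to
  the scalar \<open>V\<close>, so after division by the square root of \<open>\<bar>V\<bar>\<close> it becomes an element \<open>u\<close> with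
  \<open>u\<^sup>2 = 1\<close> or \<open>u\<^sup>2 = -1\<close>, and the exponential series of \<open>s u\<close> splits into its even part, a scalar
  series, and its odd part, a scalar series times \<open>u\<close>. If \<open>V = 0\<close>, the series stops after two terms.
\<close>

lemma exp_scaleR_square_one:
  fixes u :: "'a :: {real_normed_algebra_1, banach}"
  assumes "u * u = 1"
  shows "exp (s *\<^sub>R u) = of_real (cosh s) + sinh s *\<^sub>R u"
proof -
  have even: "u ^ (2 * m) = 1" for m
    using assms by (simp add: power_mult power2_eq_square)
  \<comment> \<open>Padding each parity with zeros gives exactly the series of
    \<open>cosh_converges\<close> and \<open>sinh_converges\<close>, so no reindexing of sums is
    needed.\<close>
  have "(s *\<^sub>R u) ^ n /\<^sub>R fact n =
      of_real (if even n then s ^ n /\<^sub>R fact n else 0) +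
      (if even n then 0 else s ^ n /\<^sub>R fact n) *\<^sub>R u" for n
    by (cases "even n") (auto elim!: evenE oddE simp: even of_real_def scaleR_power)
  moreover have "(\<lambda>n. of_real (if even n then s ^ n /\<^sub>R fact n else 0) +
      (if even n then 0 else s ^ n /\<^sub>R fact n) *\<^sub>R u) sums (of_real (cosh s) + sinh s *\<^sub>R u)"
    by (intro sums_add sums_of_real sums_scaleR_left cosh_converges sinh_converges)
  ultimately show ?thesis
    using exp_converges[of "s *\<^sub>R u"] by (simp only: sums_unique2)
qed

lemma exp_scaleR_square_minus_one:
  fixes u :: "'a :: {real_normed_algebra_1, banach}"
  assumes "u * u = - 1"
  shows "exp (s *\<^sub>R u) = of_real (cos s) + sin s *\<^sub>R u"
proof -
  have "u ^ (2 * m) = of_real ((- 1) ^ m)" for m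
    using assms by (simp add: power_mult power2_eq_square)
  \<comment> \<open>As a real multiple of 1, the sign merges with the real coefficients of the
    series.\<close>
  then have even: "u ^ (2 * m) = (- 1) ^ m *\<^sub>R 1" for m
    by (simp only: of_real_def)
  \<comment> \<open>\<open>cos_coeff\<close> vanishes at odd and \<open>sin_coeff\<close> at even
    indices, so one of the two summands is always zero.\<close>
  have "(s *\<^sub>R u) ^ n /\<^sub>R fact n =
      of_real (cos_coeff n *\<^sub>R s ^ n) + (sin_coeff n *\<^sub>R s ^ n) *\<^sub>R u" for n
    by (cases "even n")
      (auto elim!: evenE oddE
        simp: even of_real_def scaleR_power cos_coeff_def sin_coeff_def divide_simps)
  moreover have "(\<lambda>n. of_real (cos_coeff n *\<^sub>R s ^ n) + (sin_coeff n *\<^sub>R s ^ n) *\<^sub>R u)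
      sums (of_real (cos s) + sin s *\<^sub>R u)"
    by (intro sums_add sums_of_real sums_scaleR_left cos_converges sin_converges)
  ultimately show ?thesis
    using exp_converges[of "s *\<^sub>R u"] by (simp only: sums_unique2)
qed

lemma exp_square_zero:
  fixes x :: "'a :: {real_normed_algebra_1, banach}"
  assumes "x * x = 0"
  shows "exp x = 1 + x"
proof -
  have "x ^ n /\<^sub>R fact n = 0" if "n \<notin> {0, 1}" for n
  proof -
    have "n = 2 + (n - 2)" using that by auto
    then have "x ^ n = x ^ 2 * x ^ (n - 2)" by (metis power_add)
    then show ?thesis using assms by (simp add: power2_eq_square)
  qed
  then have "(\<lambda>n. x ^ n /\<^sub>R fact n) sums (\<Sum>n\<in>{0, 1}. x ^ n /\<^sub>R fact n)"
    by (intro sums_finite) auto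
  then show ?thesis
    using exp_converges[of x] sums_unique2 by fastforce
qed

lemma exp_scalar_add:
  fixes x :: "'a :: {real_normed_algebra_1, banach}"
  shows "exp (of_real r + x) = exp r *\<^sub>R exp x"
proof -
  have "exp (of_real r + x) = exp (of_real r) * exp x"
    by (intro exp_add_commuting) (simp add: of_real_def)
  then show ?thesis
    by (simp add: exp_of_real scaleR_conv_of_real)
qed

text \<open>The elements \<open>e1\<close>, \<open>e2\<close>, \<open>e3\<close> anticommute
  pairwise, so the mixed products cancel and only their squares 1, 1, -1 contribute.\<close>

lemma Im_cl2_square: "Im_cl2 a * Im_cl2 a = of_real (V_cl2 a)"
  by (simp add: cl2_eq_iff Im_cl2_def V_cl2_def e1_def e2_def e3_def of_real_def power2_eq_square)

theorem theorem2p3: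
  fixes a :: cl2 and a0 a1 a2 a3 :: real
  assumes "a = a0 *\<^sub>R 1 + a1 *\<^sub>R e1 + a2 *\<^sub>R e2 + a3 *\<^sub>R e3"
  shows "exp a =
    (if V_cl2 a > 0 then
       exp a0 *\<^sub>R (of_real (cosh (sqrt (V_cl2 a)))
         + sinh (sqrt (V_cl2 a)) *\<^sub>R (Im_cl2 a /\<^sub>R sqrt (V_cl2 a)))
     else if V_cl2 a < 0 then
       exp a0 *\<^sub>R (of_real (cos (sqrt (- V_cl2 a)))
         + sin (sqrt (- V_cl2 a)) *\<^sub>R (Im_cl2 a /\<^sub>R sqrt (- V_cl2 a)))
     else exp a0 *\<^sub>R (1 + Im_cl2 a))"
proof -
  let ?V = "V_cl2 a" and ?x = "Im_cl2 a"
  have "a = of_real a0 + ?x"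
    using assms cl2_basis[of a a0 a1 a2 a3] by (simp add: Im_cl2_def of_real_def add.assoc)
  then have exp_a: "exp a = exp a0 *\<^sub>R exp ?x"
    using exp_scalar_add by metis
  consider (pos) "?V > 0" | (neg) "?V < 0" | (zero) "?V = 0" by linarith
  then show ?thesis
  proof cases
    case pos
    let ?u = "?x /\<^sub>R sqrt ?V"
    have "?u * ?u = 1"
      using pos by (simp add: Im_cl2_square of_real_def field_simps)
    \<comment> \<open>Since \<open>sqrt ?V\<close> is nonzero, scaling \<open>?u\<close> by it gives
      back \<open>?x\<close>.\<close>
    from exp_scaleR_square_one[OF this, of "sqrt ?V"] show ?thesis
      using pos exp_a by simp
  next
    case neg
    let ?u = "?x /\<^sub>R sqrt (- ?V)"
    \<comment> \<open>The square of \<open>sqrt (- ?V)\<close> is \<open>- ?V\<close>, so the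
      quotient is \<open>?V / (- ?V)\<close>.\<close>
    have "?u * ?u = - 1"
      using neg by (simp add: Im_cl2_square of_real_def field_simps)
    from exp_scaleR_square_minus_one[OF this, of "sqrt (- ?V)"] show ?thesis
      using neg exp_a by simp
  next
    case zero
    then have "?x * ?x = 0" by (simp add: Im_cl2_square)
    from exp_square_zero[OF this] show ?thesis
      using zero exp_a by simp
  qed
qed

end
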